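(* Let $G$ be a finite undirected multigraph without loops on $n$ vertices. Let $\Delta$ be its maximal edge multiplicity, and assume $\Delta \geqslant 1$. Let $d_1 \leqslant \dots \leqslant d_n$ be its degree sequence, and let $\tau(G)$ be the number of spanning trees of $G$. Then $$\tau(G) \leqslant \frac{(\Delta+d_1)(\Delta+d_2)\cdots(\Delta+d_n)}{\Delta\, n^2}.$$
   Context: In a multigraph, two distinct vertices may be joined by several (parallel, distinguishable) edges; the multiplicity of a pair of distinct vertices is the number of edges joining them. The maximal edge multiplicity $\Delta$ is the maximum of these multiplicities over all pairs of distinct vertices. The degree of a vertex is the number of edges incident to it, counted with multiplicity. $\tau(G)$ counts spanning trees with parallel edges regarded as distinct, i.e. it is the number of sets of edges of $G$ that form a tree on all vertices of $G$. *)

theory Defs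
  imports Complex_Main "HOL-Library.Multiset"
begin

text \<open>
  Edges are named objects with a set of end vertices, so parallel edges are distinct
  elements of \<open>edges G\<close> with the same \<open>ends\<close>.
\<close>

record ('v, 'e) multigraph =
  vertices :: "'v set"
  edges :: "'e set"
  ends :: "'e \<Rightarrow> 'v set"

definition finite_loopless_multigraph :: "('v, 'e) multigraph \<Rightarrow> bool" where
  "finite_loopless_multigraph G \<longleftrightarrow>
     finite (vertices G) \<and> finite (edges G) \<and>
     (\<forall>e \<in> edges G. \<exists>u \<in> vertices G. \<exists>v \<in> vertices G. u \<noteq> v \<and> ends G e = {u, v})"

definition edge_multiplicity :: "('v, 'e) multigraph \<Rightarrow> 'v \<Rightarrow> 'v \<Rightarrow> nat" where
  "edge_multiplicity G u v = card {e \<in> edges G. ends G e = {u, v}}"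

text \<open>The inserted \<open>0\<close> only matters if \<open>G\<close> has fewer than two vertices.\<close>

definition max_edge_multiplicity :: "('v, 'e) multigraph \<Rightarrow> nat" where
  "max_edge_multiplicity G =
     Max (insert 0 {edge_multiplicity G u v | u v. u \<in> vertices G \<and> v \<in> vertices G \<and> u \<noteq> v})"

definition vertex_degree :: "('v, 'e) multigraph \<Rightarrow> 'v \<Rightarrow> nat" where
  "vertex_degree G v = card {e \<in> edges G. v \<in> ends G e}"

text \<open>In nondecreasing order, one entry for each vertex.\<close>

definition degree_sequence :: "('v, 'e) multigraph \<Rightarrow> nat list" where
  "degree_sequence G =
     sorted_list_of_multiset (image_mset (vertex_degree G) (mset_set (vertices G)))"

definition adjacency_rel :: "('v, 'e) multigraph \<Rightarrow> ('v \<times> 'v) set" where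
  "adjacency_rel G = {(u, v). \<exists>e \<in> edges G. ends G e = {u, v}}"

definition connected_multigraph :: "('v, 'e) multigraph \<Rightarrow> bool" where
  "connected_multigraph G \<longleftrightarrow>
     vertices G \<noteq> {} \<and> (\<forall>u \<in> vertices G. \<forall>v \<in> vertices G. (u, v) \<in> (adjacency_rel G)\<^sup>*)"

text \<open>
  The edge \<open>es ! i\<close> joins \<open>vs ! i\<close> to the cyclically next vertex. Two parallel edges
  form a cycle of length 2.
\<close>

definition cycle_in :: "('v, 'e) multigraph \<Rightarrow> 'v list \<Rightarrow> 'e list \<Rightarrow> bool" where
  "cycle_in G vs es \<longleftrightarrow>
     es \<noteq> [] \<and> length vs = length es \<and> distinct vs \<and> distinct es \<and>
     (\<forall>i < length es. es ! i \<in> edges G \<and>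
        ends G (es ! i) = {vs ! i, vs ! (Suc i mod length vs)})"

definition tree_multigraph :: "('v, 'e) multigraph \<Rightarrow> bool" where
  "tree_multigraph G \<longleftrightarrow> connected_multigraph G \<and> (\<nexists>vs es. cycle_in G vs es)"

definition spanning_trees :: "('v, 'e) multigraph \<Rightarrow> 'e set set" where
  "spanning_trees G = {T. T \<subseteq> edges G \<and> tree_multigraph (G\<lparr>edges := T\<rparr>)}"

definition num_spanning_trees :: "('v, 'e) multigraph \<Rightarrow> nat" where
  "num_spanning_trees G = card (spanning_trees G)"

end

theory Submission
  imports Defs "Jordan_Normal_Form.Determinant"
begin

text \<open>
  Let \<open>L\<close> be the Laplacian and \<open>J\<close> the all-ones matrix. For every \<open>t > 0\<close> the matrix \<open>L + t J\<close> is
  positive semidefinite with diagonal entries \<open>d_v + t\<close>, so Hadamard's inequality bounds its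
  determinant by \<open>\<Prod>(d_v + t)\<close>. On the other hand \<open>det (L + t J) = t n^2 det L'\<close>, where \<open>L'\<close> omits
  the row and column of one vertex, and \<open>\<tau>(G) \<le> det L'\<close> by the easy half of the matrix-tree theorem.
  Then take \<open>t = \<Delta>\<close>.

  For that half, let a set \<open>R\<close> of roots grow. If an edge \<open>e\<close> joins a root to a non-root \<open>u\<close>, then
  dropping \<open>e\<close> and additionally making \<open>u\<close> a root splits both the count of rooted forests and the
  determinant in the same way; if there is no such edge, both are trivial.
\<close>

section \<open>Determinants of matrices given as functions on index pairs\<close>

text \<open>Only the leading \<open>n\<close> by \<open>n\<close> block counts, so minors and Schur
  complements are written by shifting indices with \<open>Suc\<close>.\<close>

definition fdet :: "nat \<Rightarrow> (nat \<Rightarrow> nat \<Rightarrow> real) \<Rightarrow> real" where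
  "fdet n A = det (mat n n (\<lambda>(i, j). A i j))"

lemma fdet_cong:
  assumes "\<And>i j. i < n \<Longrightarrow> j < n \<Longrightarrow> A i j = B i j"
  shows "fdet n A = fdet n B"
  unfolding fdet_def by (rule arg_cong[of _ _ det], rule eq_matI) (use assms in auto)

lemma fdet_0 [simp]: "fdet 0 A = 1"
  by (simp add: fdet_def)

lemma fdet_mult: "fdet n (\<lambda>i j. \<Sum>k<n. A i k * B k j) = fdet n A * fdet n B"
proof -
  have "mat n n (\<lambda>(i, j). \<Sum>k<n. A i k * B k j) = mat n n (\<lambda>(i, j). A i j) * mat n n (\<lambda>(i, j). B i j)"
    by (rule eq_matI) (auto simp: scalar_prod_def atLeast0LessThan)
  then show ?thesis
    unfolding fdet_def by (simp add: det_mult[of _ n])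
qed

lemma fdet_transpose: "fdet n (\<lambda>i j. A j i) = fdet n A"
proof -
  have "mat n n (\<lambda>(i, j). A j i) = transpose_mat (mat n n (\<lambda>(i, j). A i j))"
    by (rule eq_matI) auto
  then show ?thesis
    unfolding fdet_def by (simp add: det_transpose[of _ n])
qed

lemma fdet_upper_triangular:
  assumes "\<And>i j. j < i \<Longrightarrow> i < n \<Longrightarrow> A i j = 0"
  shows "fdet n A = (\<Prod>i<n. A i i)"
  unfolding fdet_def
  by (subst det_upper_triangular[of _ n])
    (use assms in \<open>auto simp: prod_list_diag_prod atLeast0LessThan intro!: prod.cong\<close>)

lemma fdet_singular:
  assumes "\<And>i. i < n \<Longrightarrow> (\<Sum>j<n. A i j * x j) = 0" and "k < n" and "x k \<noteq> 0"
  shows "fdet n A = 0"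
proof -
  let ?M = "mat n n (\<lambda>(i, j). A i j)"
  have "vec n x \<noteq> 0\<^sub>v n"
    using assms(2,3) by (metis index_vec index_zero_vec(1))
  moreover have "?M *\<^sub>v vec n x = 0\<^sub>v n"
    by (rule eq_vecI) (use assms(1) in \<open>auto simp: scalar_prod_def atLeast0LessThan\<close>)
  ultimately show ?thesis
    unfolding fdet_def by (subst det_0_iff_vec_prod_zero[of _ n]) (auto intro!: exI[of _ "vec n x"])
qed

lemma fdet_column_0:
  assumes "\<And>i. i < n \<Longrightarrow> A (Suc i) 0 = 0"
  shows "fdet (Suc n) A = A 0 0 * fdet n (\<lambda>i j. A (Suc i) (Suc j))"
proof -
  have "mat (Suc n) (Suc n) (\<lambda>(i, j). A i j) =
      four_block_mat (mat 1 1 (\<lambda>_. A 0 0)) (mat 1 n (\<lambda>(i, j). A 0 (Suc j))) (0\<^sub>m n 1)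
        (mat n n (\<lambda>(i, j). A (Suc i) (Suc j)))"
    by (rule eq_matI) (use assms in \<open>auto simp: less_Suc_eq_0_disj\<close>)
  then show ?thesis
    unfolding fdet_def
    by (simp add: det_four_block_mat_lower_left_zero[of _ 1 _ n] det_single)
qed

text \<open>One round of Gaussian elimination: clearing column 0 below the pivot
  \<open>A 0 0\<close> is multiplication by a matrix of determinant 1.\<close>

lemma fdet_Schur:
  assumes "A 0 0 \<noteq> 0"
  shows "fdet (Suc n) A = A 0 0 * fdet n (\<lambda>i j. A (Suc i) (Suc j) - A (Suc i) 0 * A 0 (Suc j) / A 0 0)"
proof -
  define P where "P i k = (if i = k then 1 else if k = 0 then - A i 0 / A 0 0 else 0)" for i k :: nat
  have row_0: "(\<Sum>k<Suc n. P 0 k * A k j) = A 0 j" for j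
    by (subst sum.lessThan_Suc_shift) (simp add: P_def)
  have row_Suc: "(\<Sum>k<Suc n. P (Suc i) k * A k j) = A (Suc i) j - A (Suc i) 0 * A 0 j / A 0 0"
    if "i < n" for i j
    using that by (subst sum.lessThan_Suc_shift) (simp add: P_def if_distrib[of "\<lambda>x. x * _"] sum.delta cong: if_cong)
  \<comment> \<open>\<open>P\<close> is lower unitriangular, so its transpose falls under
    \<open>fdet_upper_triangular\<close>.\<close>
  have "fdet (Suc n) P = fdet (Suc n) (\<lambda>i j. P j i)"
    by (rule fdet_transpose[symmetric])
  also have "\<dots> = 1"
    by (subst fdet_upper_triangular) (auto simp: P_def)
  finally have "fdet (Suc n) A = fdet (Suc n) (\<lambda>i j. \<Sum>k<Suc n. P i k * A k j)"
    by (simp only: fdet_mult mult_1)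
  also have "\<dots> = A 0 0 * fdet n (\<lambda>i j. \<Sum>k<Suc n. P (Suc i) k * A k (Suc j))"
    by (subst fdet_column_0) (use row_0 row_Suc assms in auto)
  also have "fdet n (\<lambda>i j. \<Sum>k<Suc n. P (Suc i) k * A k (Suc j)) =
      fdet n (\<lambda>i j. A (Suc i) (Suc j) - A (Suc i) 0 * A 0 (Suc j) / A 0 0)"
    by (rule fdet_cong) (use row_Suc in auto)
  finally show ?thesis .
qed

text \<open>Expand along row \<open>u\<close>: \<open>A\<close> and \<open>B\<close> share the
  cofactors of that row, so their determinants differ by the cofactor at \<open>(u, u)\<close>. Row
  \<open>u\<close> of \<open>C\<close> is a unit vector, so that cofactor is also the determinant of
  \<open>C\<close>.\<close>

lemma fdet_add_diagonal:
  assumes u: "u < n"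
    and B: "\<And>i j. i < n \<Longrightarrow> j < n \<Longrightarrow> B i j = A i j + (if i = u \<and> j = u then 1 else 0)"
    and C: "\<And>i j. i < n \<Longrightarrow> j < n \<Longrightarrow> C i j = (if i = u \<or> j = u then if i = j then 1 else 0 else A i j)"
  shows "fdet n B = fdet n A + fdet n C"
proof -
  let ?A = "mat n n (\<lambda>(i, j). A i j)" and ?B = "mat n n (\<lambda>(i, j). B i j)" and ?C = "mat n n (\<lambda>(i, j). C i j)"
  have cof_B: "cofactor ?B u j = cofactor ?A u j" if "j < n" for j
  proof -
    have "mat_delete ?B u j = mat_delete ?A u j"
      using u by (intro eq_matI) (auto simp: mat_delete_def B)
    then show ?thesis by (simp add: cofactor_def)
  qed
  have cof_C: "cofactor ?C u u = cofactor ?A u u"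
  proof -
    have "mat_delete ?C u u = mat_delete ?A u u"
      using u by (intro eq_matI) (auto simp: mat_delete_def C)
    then show ?thesis by (simp add: cofactor_def)
  qed
  have "fdet n B = (\<Sum>j<n. ?B $$ (u, j) * cofactor ?B u j)"
    unfolding fdet_def using u by (intro laplace_expansion_row) auto
  also have "\<dots> = (\<Sum>j<n. ?A $$ (u, j) * cofactor ?A u j + (if j = u then cofactor ?A u u else 0))"
    using u by (intro sum.cong) (auto simp: cof_B B algebra_simps)
  also have "\<dots> = fdet n A + cofactor ?A u u"
    unfolding fdet_def using u by (subst laplace_expansion_row[of ?A n u]) (auto simp: sum.distrib sum.delta)
  also have "cofactor ?A u u = (\<Sum>j<n. ?C $$ (u, j) * cofactor ?C u j)"
  proof -
    have "(\<Sum>j<n. ?C $$ (u, j) * cofactor ?C u j) = (\<Sum>j<n. if j = u then cofactor ?A u u else 0)"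
      using u by (intro sum.cong) (auto simp: C cof_C)
    then show ?thesis using u by simp
  qed
  also have "\<dots> = fdet n C"
    unfolding fdet_def using u by (intro laplace_expansion_row[symmetric]) auto
  finally show ?thesis .
qed

section \<open>Positive semidefinite matrices and Hadamard's inequality\<close>

text \<open>Symmetry is demanded separately because the quadratic form sees only the symmetric part
  of \<open>A\<close>.\<close>

definition psd :: "nat \<Rightarrow> (nat \<Rightarrow> nat \<Rightarrow> real) \<Rightarrow> bool" where
  "psd n A \<longleftrightarrow> (\<forall>i<n. \<forall>j<n. A i j = A j i) \<and> (\<forall>x. 0 \<le> (\<Sum>i<n. \<Sum>j<n. A i j * x i * x j))"

lemma psd_quadratic_form_nonneg: "psd n A \<Longrightarrow> 0 \<le> (\<Sum>i<n. \<Sum>j<n. A i j * x i * x j)"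
  by (simp add: psd_def)

lemma psd_quadratic_form_Suc:
  assumes "psd (Suc n) A"
  shows "(\<Sum>i<Suc n. \<Sum>j<Suc n. A i j * x i * x j) =
    A 0 0 * x 0 ^ 2 + 2 * x 0 * (\<Sum>i<n. A (Suc i) 0 * x (Suc i)) +
    (\<Sum>i<n. \<Sum>j<n. A (Suc i) (Suc j) * x (Suc i) * x (Suc j))"
proof -
  have "A 0 (Suc i) = A (Suc i) 0" if "i < n" for i
    using assms that by (auto simp: psd_def)
  then have "(\<Sum>i<n. A 0 (Suc i) * x 0 * x (Suc i)) = (\<Sum>i<n. x 0 * (A (Suc i) 0 * x (Suc i)))"
    by (intro sum.cong) auto
  then show ?thesis
    unfolding sum.lessThan_Suc_shift sum.distrib
    by (simp add: sum_distrib_left power2_eq_square algebra_simps del: sum.lessThan_Suc)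
qed

lemma psd_diagonal_nonneg:
  assumes "psd n A" and "k < n"
  shows "0 \<le> A k k"
proof -
  let ?x = "\<lambda>i. if i = k then 1 else 0 :: real"
  have "(\<Sum>i<n. \<Sum>j<n. A i j * ?x i * ?x j) = A k k"
    using assms(2) by (simp add: if_distrib[of "\<lambda>x. _ * x"] sum.delta cong: if_cong)
  moreover have "0 \<le> (\<Sum>i<n. \<Sum>j<n. A i j * ?x i * ?x j)"
    by (rule psd_quadratic_form_nonneg[OF assms(1)])
  ultimately show ?thesis by linarith
qed

text \<open>If the corner entry vanishes, the form is affine in \<open>x 0\<close>; a nonzero
  coefficient would make it negative somewhere.\<close>

lemma psd_column_0:
  assumes "psd (Suc n) A" and "A 0 0 = 0" and "k < n"
  shows "A (Suc k) 0 = 0"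
proof (rule ccontr)
  let ?a = "A (Suc k) 0" and ?b = "A (Suc k) (Suc k)"
  assume a: "?a \<noteq> 0"
  \<comment> \<open>The value at 0 solves \<open>2 * x 0 * ?a + ?b = -1\<close>.\<close>
  define x :: "nat \<Rightarrow> real" where "x i = (if i = 0 then - (?b + 1) / (2 * ?a) else if i = Suc k then 1 else 0)" for i
  have "0 \<le> (\<Sum>i<Suc n. \<Sum>j<Suc n. A i j * x i * x j)"
    by (rule psd_quadratic_form_nonneg[OF assms(1)])
  also have "\<dots> = 2 * x 0 * (\<Sum>i<n. A (Suc i) 0 * x (Suc i)) +
    (\<Sum>i<n. \<Sum>j<n. A (Suc i) (Suc j) * x (Suc i) * x (Suc j))"
    using psd_quadratic_form_Suc[OF assms(1)] assms(2) by simp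
  also have "(\<Sum>i<n. A (Suc i) 0 * x (Suc i)) = ?a"
    using assms(3) by (simp add: x_def if_distrib[of "\<lambda>x. _ * x"] sum.delta cong: if_cong)
  also have "(\<Sum>i<n. \<Sum>j<n. A (Suc i) (Suc j) * x (Suc i) * x (Suc j)) = ?b"
    using assms(3) by (simp add: x_def if_distrib[of "\<lambda>x. _ * x"] sum.delta cong: if_cong)
  also have "2 * x 0 * ?a + ?b = -1"
    using a by (simp add: x_def field_simps)
  finally show False by simp
qed

text \<open>The form of the Schur complement at \<open>x\<close> is the minimum of the form of
  \<open>A\<close> over all ways to prepend a coordinate to \<open>x\<close>.\<close>

lemma psd_Schur:
  assumes "psd (Suc n) A" and "A 0 0 > 0"
  shows "psd n (\<lambda>i j. A (Suc i) (Suc j) - A (Suc i) 0 * A 0 (Suc j) / A 0 0)"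
  unfolding psd_def
proof (intro conjI allI impI)
  fix i j assume "i < n" "j < n"
  then have "A (Suc i) (Suc j) = A (Suc j) (Suc i)" "A 0 (Suc j) = A (Suc j) 0" "A (Suc i) 0 = A 0 (Suc i)"
    using assms(1) by (auto simp: psd_def)
  then show "A (Suc i) (Suc j) - A (Suc i) 0 * A 0 (Suc j) / A 0 0 =
      A (Suc j) (Suc i) - A (Suc j) 0 * A 0 (Suc i) / A 0 0"
    by simp
next
  fix x :: "nat \<Rightarrow> real"
  define s where "s = (\<Sum>i<n. A (Suc i) 0 * x i)"
  \<comment> \<open>The prepended coordinate \<open>- s / A 0 0\<close> is the minimizer, found by
    completing the square.\<close>
  define y where "y i = (case i of 0 \<Rightarrow> - s / A 0 0 | Suc i \<Rightarrow> x i)" for i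
  define q where "q = (\<Sum>i<n. \<Sum>j<n. A (Suc i) (Suc j) * x i * x j)"
  have sym: "A 0 (Suc i) = A (Suc i) 0" if "i < n" for i
    using assms(1) that by (auto simp: psd_def)
  have "0 \<le> (\<Sum>i<Suc n. \<Sum>j<Suc n. A i j * y i * y j)"
    by (rule psd_quadratic_form_nonneg[OF assms(1)])
  also have "\<dots> = A 0 0 * (s / A 0 0) ^ 2 - 2 * (s / A 0 0) * s + q"
    unfolding psd_quadratic_form_Suc[OF assms(1)] by (simp add: y_def s_def q_def)
  also have "\<dots> = q - s * s / A 0 0"
    using assms(2) by (simp add: field_simps power2_eq_square)
  also have "s * s = (\<Sum>i<n. \<Sum>j<n. (A (Suc i) 0 * x i) * (A (Suc j) 0 * x j))"
    unfolding s_def by (rule sum_product)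
  also have "\<dots> = (\<Sum>i<n. \<Sum>j<n. A (Suc i) 0 * A 0 (Suc j) * x i * x j)"
    by (intro sum.cong refl) (simp add: sym)
  also have "q - \<dots> / A 0 0 =
      (\<Sum>i<n. \<Sum>j<n. (A (Suc i) (Suc j) - A (Suc i) 0 * A 0 (Suc j) / A 0 0) * x i * x j)"
    by (simp add: q_def sum_divide_distrib sum_subtractf left_diff_distrib)
  finally show "0 \<le> (\<Sum>i<n. \<Sum>j<n. (A (Suc i) (Suc j) - A (Suc i) 0 * A 0 (Suc j) / A 0 0) * x i * x j)" .
qed

text \<open>Induction by elimination: passing to the Schur complement preserves semidefiniteness and
  can only lower the diagonal entries.\<close>

lemma Hadamard_psd:
  assumes "psd n A"
  shows "fdet n A \<le> (\<Prod>i<n. A i i)"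
  using assms
proof (induction n arbitrary: A)
  case 0
  then show ?case by simp
next
  case (Suc n)
  have a: "0 \<le> A 0 0"
    using psd_diagonal_nonneg[OF Suc.prems, of 0] by simp
  show ?case
  proof (cases "A 0 0 = 0")
    case True
    \<comment> \<open>Column 0 vanishes, and both sides are 0.\<close>
    then show ?thesis
      using psd_column_0[OF Suc.prems True] by (simp add: fdet_column_0 prod.lessThan_Suc_shift del: prod.lessThan_Suc)
  next
    case False
    let ?B = "\<lambda>i j. A (Suc i) (Suc j) - A (Suc i) 0 * A 0 (Suc j) / A 0 0"
    have psd_B: "psd n ?B"
      using psd_Schur[OF Suc.prems] a False by simp
    have "fdet n ?B \<le> (\<Prod>i<n. ?B i i)"
      by (rule Suc.IH[OF psd_B])
    also have "\<dots> \<le> (\<Prod>i<n. A (Suc i) (Suc i))"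
    proof (intro prod_mono conjI)
      fix i assume "i \<in> {..<n}"
      then show "0 \<le> ?B i i"
        using psd_diagonal_nonneg[OF psd_B] by simp
      have "A 0 (Suc i) = A (Suc i) 0"
        using Suc.prems \<open>i \<in> {..<n}\<close> by (auto simp: psd_def)
      \<comment> \<open>By symmetry the subtracted term is a square divided by the pivot.\<close>
      then show "?B i i \<le> A (Suc i) (Suc i)"
        using a by simp
    qed
    finally show ?thesis
      using a False by (simp add: fdet_Schur prod.lessThan_Suc_shift mult_left_mono del: prod.lessThan_Suc)
  qed
qed

section \<open>The determinant of \<open>A + t J\<close> when the rows and columns of
  \<open>A\<close> sum to zero\<close>

lemma fdet_add_constant:
  assumes row: "\<And>i. i < Suc m \<Longrightarrow> (\<Sum>j<Suc m. A i j) = 0"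
    and col: "\<And>j. j < Suc m \<Longrightarrow> (\<Sum>i<Suc m. A i j) = 0"
    and t: "t \<noteq> 0"
  shows "fdet (Suc m) (\<lambda>i j. A i j + t) = t * real (Suc m) ^ 2 * fdet m (\<lambda>i j. A (Suc i) (Suc j))"
proof -
  define n where "n = Suc m"
  have col_n: "(\<Sum>i<n. A i j) = 0" if "j < n" for j
    using col that unfolding n_def .
  \<comment> \<open>Passing from \<open>A + t J\<close> to \<open>C (A + t J) C^T\<close> replaces row and column \<open>0\<close> by the row and column
    sums, after which pivoting on the corner entry \<open>t n^2\<close> cancels the constant \<open>t\<close> elsewhere.\<close>
  define C where "C i j = (if i = 0 \<or> i = j then 1 else 0 :: real)" for i j :: nat
  have C_left: "(\<Sum>k<n. C i k * X k) = (if i = 0 then \<Sum>k<n. X k else X i)" if "i < n" for i X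
    using that by (auto simp: C_def if_distrib[of "\<lambda>x. x * _"] sum.delta cong: if_cong)
  \<comment> \<open>On indices below \<open>n\<close>, \<open>B\<close> is
    \<open>C (A + t J)\<close> and \<open>D\<close> is \<open>B C^T\<close>; in row 0 of
    \<open>B\<close> the column sums of \<open>A\<close> have already vanished.\<close>
  define B where "B i j = (if i = 0 then real n * t else A i j + t)" for i j
  define D where "D i j = (if j = 0 then \<Sum>k<n. B i k else B i j)" for i j
  have "fdet n C = 1"
    by (subst fdet_upper_triangular) (auto simp: C_def)
  then have "fdet n (\<lambda>i j. A i j + t) = fdet n (\<lambda>i j. \<Sum>k<n. C i k * (A k j + t))"
    using fdet_mult[of n C] by simp
  also have "\<dots> = fdet n B"
    by (rule fdet_cong) (auto simp: C_left B_def sum.distrib col_n)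
  also have "\<dots> = fdet n (\<lambda>i j. \<Sum>k<n. B i k * C j k)"
    using fdet_mult[of n B "\<lambda>i j. C j i"] fdet_transpose[of n C] \<open>fdet n C = 1\<close> by simp
  also have "\<dots> = fdet n D"
  proof (rule fdet_cong)
    fix i j assume "j < n"
    then show "(\<Sum>k<n. B i k * C j k) = D i j"
      using C_left[of j "B i"] by (simp add: D_def mult.commute)
  qed
  also have "\<dots> = D 0 0 * fdet m (\<lambda>i j. D (Suc i) (Suc j) - D (Suc i) 0 * D 0 (Suc j) / D 0 0)"
    unfolding n_def by (rule fdet_Schur) (use t in \<open>simp add: D_def B_def n_def\<close>)
  also have "D 0 0 = t * real n ^ 2"
    by (simp add: D_def B_def power2_eq_square)
  also have "fdet m (\<lambda>i j. D (Suc i) (Suc j) - D (Suc i) 0 * D 0 (Suc j) / (t * real n ^ 2)) =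
      fdet m (\<lambda>i j. A (Suc i) (Suc j))"
  proof (rule fdet_cong)
    fix i j assume "i < m" "j < m"
    then have "D (Suc i) 0 = real n * t"
      using row[of "Suc i"] by (simp add: D_def B_def sum.distrib n_def del: sum.lessThan_Suc)
    \<comment> \<open>The correction is \<open>(n t) (n t) / (t n^2) = t\<close>, exactly the
      constant added to \<open>A\<close>.\<close>
    then show "D (Suc i) (Suc j) - D (Suc i) 0 * D 0 (Suc j) / (t * real n ^ 2) = A (Suc i) (Suc j)"
      using t by (simp add: D_def B_def power2_eq_square n_def)
  qed
  finally show ?thesis
    unfolding n_def .
qed


section \<open>Rooted forests as minimal covers, and spanning trees among them\<close>

text \<open>This is \<open>adjacency_rel\<close> with the edge set as a separate argument, so that
  edges can be removed while the incidences stay fixed.\<close>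

definition joined :: "('e \<Rightarrow> 'v set) \<Rightarrow> 'e set \<Rightarrow> ('v \<times> 'v) set" where
  "joined h T = {(x, y). \<exists>e\<in>T. h e = {x, y}}"

definition covers :: "('e \<Rightarrow> 'v set) \<Rightarrow> 'v set \<Rightarrow> 'v set \<Rightarrow> 'e set \<Rightarrow> bool" where
  "covers h V R T \<longleftrightarrow> V \<subseteq> (joined h T)\<^sup>* `` R"

text \<open>The rooted forests: every vertex of \<open>V\<close> reaches a root in \<open>R\<close>, and no edge is superfluous.\<close>

definition minimal_cover :: "('e \<Rightarrow> 'v set) \<Rightarrow> 'v set \<Rightarrow> 'v set \<Rightarrow> 'e set \<Rightarrow> bool" where
  "minimal_cover h V R T \<longleftrightarrow> covers h V R T \<and> (\<forall>e\<in>T. \<not> covers h V R (T - {e}))"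

lemma joined_mono: "S \<subseteq> T \<Longrightarrow> joined h S \<subseteq> joined h T"
  by (auto simp: joined_def)

lemma sym_joined: "sym (joined h T)"
  by (auto simp: joined_def sym_def insert_commute)

lemma minimal_cover_contract:
  assumes T: "minimal_cover h V R T" and e: "e \<in> T" "h e = {r, u}" and r: "r \<in> R"
  shows "minimal_cover h V (insert u R) (T - {e})"
  unfolding minimal_cover_def
proof (intro conjI ballI notI)
  have "y \<in> (joined h (T - {e}))\<^sup>* `` insert u R" if "(x, y) \<in> (joined h T)\<^sup>*" "x \<in> R" for x y
    using that(1)
  proof (induction rule: rtrancl_induct)
    case base
    then show ?case using that(2) by auto
  next
    case (step y z)
    then obtain e' where e': "e' \<in> T" "h e' = {y, z}"
      by (auto simp: joined_def)
    show ?case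
    proof (cases "e' = e")
      case True
      \<comment> \<open>After a use of \<open>e\<close> the path stands at \<open>r\<close> or
        \<open>u\<close>, so it can be restarted there as a path from a root.\<close>
      then have "z \<in> insert u R"
        using e'(2) e(2) r by (auto simp: doubleton_eq_iff)
      then show ?thesis by auto
    next
      case False
      then have "(y, z) \<in> joined h (T - {e})"
        using e' by (auto simp: joined_def)
      then show ?thesis
        using step.IH by (auto intro: rtrancl_into_rtrancl)
    qed
  qed
  then show "covers h V (insert u R) (T - {e})"
    using T unfolding minimal_cover_def covers_def by blast
next
  fix e' assume e': "e' \<in> T - {e}" and "covers h V (insert u R) (T - {e} - {e'})"
  have ru: "(r, u) \<in> joined h (T - {e'})"
    using e e' by (auto simp: joined_def)
  have sub: "(joined h (T - {e} - {e'}))\<^sup>* \<subseteq> (joined h (T - {e'}))\<^sup>*"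
    by (intro rtrancl_mono joined_mono) auto
  have "covers h V R (T - {e'})"
    unfolding covers_def
  proof
    fix y assume "y \<in> V"
    then obtain x where x: "x \<in> insert u R" "(x, y) \<in> (joined h (T - {e'}))\<^sup>*"
      using \<open>covers h V (insert u R) (T - {e} - {e'})\<close> sub unfolding covers_def by blast
    show "y \<in> (joined h (T - {e'}))\<^sup>* `` R"
    proof (cases "x = u")
      case True
      then have "(r, y) \<in> (joined h (T - {e'}))\<^sup>*"
        using x(2) ru by (simp add: converse_rtrancl_into_rtrancl)
      then show ?thesis using r by blast
    next
      case False
      then show ?thesis using x by blast
    qed
  qed
  then show False
    using T e' unfolding minimal_cover_def by blast
qed

text \<open>Extend the walk edge by edge; on a return to an earlier vertex, cut it back to that
  vertex. Distinct vertices are what \<open>cycle_in\<close> asks for.\<close>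

lemma distinct_walk:
  assumes "(u, v) \<in> (joined h T)\<^sup>*"
  shows "\<exists>vs es. distinct vs \<and> length vs = Suc (length es) \<and> vs ! 0 = u \<and> vs ! length es = v \<and>
    (\<forall>i<length es. es ! i \<in> T \<and> h (es ! i) = {vs ! i, vs ! Suc i})"
  using assms
proof (induction rule: rtrancl_induct)
  case base
  show ?case
    by (rule exI[of _ "[u]"], rule exI[of _ "[]"]) simp
next
  case (step y z)
  then obtain vs es where w: "distinct vs" "length vs = Suc (length es)" "vs ! 0 = u" "vs ! length es = y"
    "\<forall>i<length es. es ! i \<in> T \<and> h (es ! i) = {vs ! i, vs ! Suc i}"
    by blast
  obtain e where e: "e \<in> T" "h e = {y, z}"
    using step.hyps(2) by (auto simp: joined_def)
  show ?case
  proof (cases "z \<in> set vs")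
    case True
    then obtain k where k: "k < length vs" "vs ! k = z"
      by (auto simp: in_set_conv_nth)
    show ?thesis
      by (rule exI[of _ "take (Suc k) vs"], rule exI[of _ "take k es"]) (use w k in auto)
  next
    case False
    have "(vs @ [z]) ! 0 = u"
      using w(2,3) by (simp add: nth_append)
    moreover have "(es @ [e]) ! i \<in> T \<and> h ((es @ [e]) ! i) = {(vs @ [z]) ! i, (vs @ [z]) ! Suc i}"
      if "i < length (es @ [e])" for i
      using that w e by (cases "i < length es") (auto simp: nth_append less_Suc_eq)
    ultimately show ?thesis
      using w False
      by (intro exI[of _ "vs @ [z]"] exI[of _ "es @ [e]"]) (auto simp: nth_append)
  qed
qed

text \<open>The edge \<open>e\<close> closes a walk from \<open>u\<close> to \<open>v\<close> inside
  \<open>T\<close> to a cycle.\<close>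

lemma cycle_in_if_joined:
  assumes T: "T \<subseteq> edges G" and e: "e \<in> edges G" "e \<notin> T" "ends G e = {u, v}"
    and uv: "(u, v) \<in> (joined (ends G) T)\<^sup>*"
  shows "\<exists>vs es. cycle_in G vs es"
proof -
  obtain vs es where w: "distinct vs" "length vs = Suc (length es)" "vs ! 0 = u" "vs ! length es = v"
    "\<forall>i<length es. es ! i \<in> T \<and> ends G (es ! i) = {vs ! i, vs ! Suc i}"
    using distinct_walk[OF uv] by blast
  \<comment> \<open>If an edge occurred at positions \<open>i < j\<close>, the vertex
    \<open>vs ! i\<close> would reappear at position \<open>j\<close> or
    \<open>Suc j\<close>.\<close>
  have "es ! i \<noteq> es ! j" if "i < j" "j < length es" for i j
  proof
    assume "es ! i = es ! j"
    then have "{vs ! i, vs ! Suc i} = {vs ! j, vs ! Suc j}"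
      using w(5) that by (metis less_trans)
    then have "vs ! i = vs ! j \<or> vs ! i = vs ! Suc j"
      by (auto simp: doubleton_eq_iff)
    then show False
      using w(1,2) that by (auto simp: nth_eq_iff_index_eq)
  qed
  then have "distinct es"
    unfolding distinct_conv_nth by (metis nat_neq_iff)
  moreover have "e \<notin> set es"
    using w(5) e(2) by (auto simp: in_set_conv_nth)
  \<comment> \<open>For \<open>i = length es\<close> the index wraps round to 0: this is the closing
    edge \<open>e\<close>.\<close>
  moreover have "(es @ [e]) ! i \<in> edges G \<and>
      ends G ((es @ [e]) ! i) = {vs ! i, vs ! (Suc i mod length vs)}" if "i < Suc (length es)" for i
    using that w T e by (cases "i < length es") (auto simp: nth_append less_Suc_eq_le mod_less insert_commute)
  ultimately have "cycle_in G vs (es @ [e])"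
    using w(1,2) unfolding cycle_in_def by simp
  then show ?thesis by blast
qed

lemma minimal_cover_spanning_tree:
  assumes G: "finite_loopless_multigraph G" and T: "T \<in> spanning_trees G" and r: "r \<in> vertices G"
  shows "minimal_cover (ends G) (vertices G) {r} T"
  unfolding minimal_cover_def
proof (intro conjI ballI notI)
  have sub: "T \<subseteq> edges G" and conn: "connected_multigraph (G\<lparr>edges := T\<rparr>)"
    and acyclic: "\<nexists>vs es. cycle_in (G\<lparr>edges := T\<rparr>) vs es"
    using T by (auto simp: spanning_trees_def tree_multigraph_def)
  show "covers (ends G) (vertices G) {r} T"
    using conn r by (auto simp: connected_multigraph_def covers_def adjacency_rel_def joined_def)
  fix e assume e: "e \<in> T" and cov: "covers (ends G) (vertices G) {r} (T - {e})"
  obtain u v where uv: "u \<in> vertices G" "v \<in> vertices G" "ends G e = {u, v}"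
    using G e sub unfolding finite_loopless_multigraph_def by blast
  then have "(r, u) \<in> (joined (ends G) (T - {e}))\<^sup>*" "(r, v) \<in> (joined (ends G) (T - {e}))\<^sup>*"
    using cov by (auto simp: covers_def)
  then have "(u, v) \<in> (joined (ends G) (T - {e}))\<^sup>*"
    using sym_joined[of "ends G" "T - {e}"] by (meson rtrancl_trans symD sym_rtrancl)
  then have "\<exists>vs es. cycle_in (G\<lparr>edges := T\<rparr>) vs es"
    using e uv by (intro cycle_in_if_joined[of "T - {e}" _ e u v]) auto
  then show False using acyclic by blast
qed

section \<open>The Laplacian and the matrix-tree inequality\<close>

text \<open>As a sum over edges, it loses one summand when an edge is deleted, and for a loopless
  edge with injective \<open>f\<close> each summand has rank one.\<close>

definition laplacian :: "('e \<Rightarrow> 'v set) \<Rightarrow> (nat \<Rightarrow> 'v) \<Rightarrow> 'e set \<Rightarrow> nat \<Rightarrow> nat \<Rightarrow> real" where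
  "laplacian h f E i j =
     (\<Sum>e\<in>E. if f i \<in> h e \<and> f j \<in> h e then if i = j then 1 else - 1 else 0)"

text \<open>
  Instead of deleting the rows and columns of \<open>R\<close> we replace them by those of the identity, which
  gives the same determinant without re-indexing.
\<close>

definition grounded_laplacian ::
    "('e \<Rightarrow> 'v set) \<Rightarrow> (nat \<Rightarrow> 'v) \<Rightarrow> 'v set \<Rightarrow> 'e set \<Rightarrow> nat \<Rightarrow> nat \<Rightarrow> real" where
  "grounded_laplacian h f R E i j =
     (if f i \<in> R \<or> f j \<in> R then if i = j then 1 else 0 else laplacian h f E i j)"

lemma laplacian_sym: "laplacian h f E i j = laplacian h f E j i"
  unfolding laplacian_def by (intro sum.cong) auto

locale enumerated_multigraph =
  fixes h :: "'e \<Rightarrow> 'v set" and V :: "'v set" and n :: nat and f :: "nat \<Rightarrow> 'v"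
  assumes enum: "bij_betw f {..<n} V"
begin

text \<open>A predicate rather than a locale assumption, because the edge set shrinks in the
  induction of \<open>card_minimal_covers_le_fdet\<close>.\<close>

definition edge_set :: "'e set \<Rightarrow> bool" where
  "edge_set E \<longleftrightarrow> finite E \<and> (\<forall>e\<in>E. \<exists>u\<in>V. \<exists>v\<in>V. u \<noteq> v \<and> h e = {u, v})"

lemma enum_eq_iff: "i < n \<Longrightarrow> j < n \<Longrightarrow> f i = f j \<longleftrightarrow> i = j"
  using enum by (auto simp: bij_betw_def inj_on_def)

lemma enum_obtain:
  assumes "v \<in> V"
  obtains i where "i < n" "f i = v"
  using enum assms by (auto simp: bij_betw_def)

text \<open>Orient each edge arbitrarily and let \<open>b e\<close> be 1 at one end, -1 at the other
  and 0 elsewhere.\<close>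

lemma incidence_vectors:
  assumes "edge_set E"
  obtains b :: "'e \<Rightarrow> nat \<Rightarrow> real" where
    "\<And>i j. i < n \<Longrightarrow> j < n \<Longrightarrow> laplacian h f E i j = (\<Sum>e\<in>E. b e i * b e j)"
    "\<And>e. e \<in> E \<Longrightarrow> (\<Sum>i<n. b e i) = 0"
proof -
  have "\<exists>b :: nat \<Rightarrow> real. (\<forall>i<n. \<forall>j<n. (if f i \<in> h e \<and> f j \<in> h e then if i = j then 1 else - 1 else 0) = b i * b j) \<and>
      (\<Sum>i<n. b i) = 0" if e: "e \<in> E" for e
  proof -
    obtain u v where "u \<in> V" "v \<in> V" "u \<noteq> v" "h e = {u, v}"
      using assms e unfolding edge_set_def by blast
    then obtain k l where kl: "k < n" "l < n" "k \<noteq> l" "h e = {f k, f l}"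
      by (metis enum_obtain)
    define b :: "nat \<Rightarrow> real" where "b i = (if i = k then 1 else 0) - (if i = l then 1 else 0)" for i
    have "(\<Sum>i<n. b i) = 0"
      using kl by (simp add: b_def sum_subtractf)
    moreover have "(if f i \<in> h e \<and> f j \<in> h e then if i = j then 1 else - 1 else 0) = b i * b j"
      if "i < n" "j < n" for i j
      using that kl by (auto simp: b_def enum_eq_iff)
    ultimately show ?thesis by blast
  qed
  then obtain b :: "'e \<Rightarrow> nat \<Rightarrow> real" where b:
    "\<And>e i j. e \<in> E \<Longrightarrow> i < n \<Longrightarrow> j < n \<Longrightarrow>
       (if f i \<in> h e \<and> f j \<in> h e then if i = j then 1 else - 1 else 0) = b e i * b e j"
    "\<And>e. e \<in> E \<Longrightarrow> (\<Sum>i<n. b e i) = 0"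
    by metis
  show thesis
    by (rule that[of b]) (use b in \<open>auto simp: laplacian_def intro!: sum.cong\<close>)
qed

lemma laplacian_row_sum:
  assumes "edge_set E" and "i < n"
  shows "(\<Sum>j<n. laplacian h f E i j) = 0"
proof -
  obtain b :: "'e \<Rightarrow> nat \<Rightarrow> real" where b:
    "\<And>i j. i < n \<Longrightarrow> j < n \<Longrightarrow> laplacian h f E i j = (\<Sum>e\<in>E. b e i * b e j)"
    "\<And>e. e \<in> E \<Longrightarrow> (\<Sum>i<n. b e i) = 0"
    using incidence_vectors[OF assms(1)] by blast
  have "(\<Sum>j<n. laplacian h f E i j) = (\<Sum>j<n. \<Sum>e\<in>E. b e i * b e j)"
    using b(1) assms(2) by simp
  also have "\<dots> = (\<Sum>e\<in>E. b e i * (\<Sum>j<n. b e j))"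
    by (subst sum.swap) (simp add: sum_distrib_left)
  also have "\<dots> = 0"
    using b(2) by simp
  finally show ?thesis .
qed

text \<open>The form is a sum of squares: one of \<open>b e\<close> paired with \<open>x\<close> for
  each edge, plus \<open>t\<close> times the square of the sum of \<open>x\<close>.\<close>

lemma psd_laplacian_add_constant:
  assumes "edge_set E" and "t \<ge> 0"
  shows "psd n (\<lambda>i j. laplacian h f E i j + t)"
  unfolding psd_def
proof (intro conjI allI impI)
  fix i j
  show "laplacian h f E i j + t = laplacian h f E j i + t"
    using laplacian_sym[of h f E i j] by simp
next
  fix x :: "nat \<Rightarrow> real"
  obtain b :: "'e \<Rightarrow> nat \<Rightarrow> real" where b:
    "\<And>i j. i < n \<Longrightarrow> j < n \<Longrightarrow> laplacian h f E i j = (\<Sum>e\<in>E. b e i * b e j)"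
    by (rule incidence_vectors[OF assms(1)]) blast
  have square: "(\<Sum>i<n. y i) ^ 2 = (\<Sum>i<n. \<Sum>j<n. y i * y j)" for y :: "nat \<Rightarrow> real"
    by (simp add: power2_eq_square sum_product)
  have "(\<Sum>i<n. \<Sum>j<n. (laplacian h f E i j + t) * x i * x j) =
      (\<Sum>i<n. \<Sum>j<n. (\<Sum>e\<in>E. (b e i * x i) * (b e j * x j)) + t * (x i * x j))"
    by (intro sum.cong) (auto simp: b sum_distrib_left sum_distrib_right algebra_simps)
  also have "\<dots> = (\<Sum>i<n. \<Sum>e\<in>E. \<Sum>j<n. (b e i * x i) * (b e j * x j)) + t * (\<Sum>i<n. x i) ^ 2"
    unfolding sum.distrib square by (subst sum.swap[of _ "{..<n}" E]) (simp add: sum_distrib_left)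
  also have "\<dots> = (\<Sum>e\<in>E. (\<Sum>i<n. b e i * x i) ^ 2) + t * (\<Sum>i<n. x i) ^ 2"
    unfolding square by (subst sum.swap) simp
  also have "\<dots> \<ge> 0"
    using assms(2) by (intro add_nonneg_nonneg sum_nonneg mult_nonneg_nonneg) auto
  finally show "0 \<le> (\<Sum>i<n. \<Sum>j<n. (laplacian h f E i j + t) * x i * x j)" .
qed

text \<open>As \<open>r\<close> is grounded, deleting \<open>e\<close> alters only the diagonal
  entry at \<open>u\<close>, by 1; grounding \<open>u\<close> as well gives the third matrix of
  \<open>fdet_add_diagonal\<close>.\<close>

lemma fdet_grounded_laplacian_contract:
  assumes E: "finite E" and e: "e \<in> E" "h e = {r, u}" and r: "r \<in> R" and u: "u \<in> V" "u \<notin> R"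
  shows "fdet n (grounded_laplacian h f R E) =
    fdet n (grounded_laplacian h f R (E - {e})) + fdet n (grounded_laplacian h f (insert u R) (E - {e}))"
proof -
  obtain k where k: "k < n" "f k = u"
    using u(1) by (rule enum_obtain)
  show ?thesis
  proof (rule fdet_add_diagonal[OF k(1)])
    fix i j assume ij: "i < n" "j < n"
    have "laplacian h f E i j = laplacian h f (E - {e}) i j +
        (if f i \<in> h e \<and> f j \<in> h e then if i = j then 1 else - 1 else 0)"
      unfolding laplacian_def using E e(1) by (subst sum.remove[of E e]) auto
    then show "grounded_laplacian h f R E i j =
        grounded_laplacian h f R (E - {e}) i j + (if i = k \<and> j = k then 1 else 0)"
      using ij k e(2) r u(2) by (auto simp: grounded_laplacian_def enum_eq_iff)
    show "grounded_laplacian h f (insert u R) (E - {e}) i j =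
        (if i = k \<or> j = k then if i = j then 1 else 0 else grounded_laplacian h f R (E - {e}) i j)"
      using ij k by (auto simp: grounded_laplacian_def enum_eq_iff)
  qed
qed

text \<open>No edge leaves \<open>R\<close>, so the indicator of the complement of \<open>R\<close>
  lies in the kernel; it is nonzero at \<open>v\<close>.\<close>

lemma fdet_grounded_laplacian_singular:
  assumes E: "edge_set E" and v: "v \<in> V" "v \<notin> R"
    and no_edge: "\<And>e r u. e \<in> E \<Longrightarrow> r \<in> R \<Longrightarrow> u \<notin> R \<Longrightarrow> r \<in> h e \<Longrightarrow> u \<in> h e \<Longrightarrow> False"
  shows "fdet n (grounded_laplacian h f R E) = 0"
proof -
  obtain k where k: "k < n" "f k = v"
    using v(1) by (rule enum_obtain)
  let ?x = "\<lambda>j. if f j \<in> R then 0 else 1 :: real"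
  show ?thesis
  proof (rule fdet_singular[of n _ ?x k])
    fix i assume i: "i < n"
    show "(\<Sum>j<n. grounded_laplacian h f R E i j * ?x j) = 0"
    proof (cases "f i \<in> R")
      case True
      then show ?thesis
        by (intro sum.neutral) (auto simp: grounded_laplacian_def)
    next
      case False
      have "laplacian h f E i j = 0" if "f j \<in> R" for j
        unfolding laplacian_def using no_edge that False by (intro sum.neutral) auto
      then have "(\<Sum>j<n. grounded_laplacian h f R E i j * ?x j) = (\<Sum>j<n. laplacian h f E i j)"
        using False by (intro sum.cong) (auto simp: grounded_laplacian_def)
      then show ?thesis
        using laplacian_row_sum[OF E i] by simp
    qed
  qed (use k v in auto)
qed

text \<open>The induction on the number of edges keeps \<open>R\<close> arbitrary, since one of the
  two branches enlarges it.\<close>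

lemma card_minimal_covers_le_fdet:
  assumes "edge_set E" and "R \<subseteq> V"
  shows "real (card {T. T \<subseteq> E \<and> minimal_cover h V R T}) \<le> fdet n (grounded_laplacian h f R E)"
  using assms
proof (induction "card E" arbitrary: E R rule: less_induct)
  case less
  have fin: "finite E" and E: "\<And>e. e \<in> E \<Longrightarrow> \<exists>u\<in>V. \<exists>v\<in>V. u \<noteq> v \<and> h e = {u, v}"
    using less.prems(1) by (auto simp: edge_set_def)
  show ?case
  proof (cases "\<exists>e\<in>E. \<exists>r\<in>R. \<exists>u. u \<notin> R \<and> r \<in> h e \<and> u \<in> h e")
    case True
    then obtain e r u where e: "e \<in> E" and r: "r \<in> R" and u: "u \<notin> R" and "r \<in> h e" "u \<in> h e"
      by blast
    then have he: "h e = {r, u}" "u \<in> V"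
      using E[OF e] by auto
    have smaller: "card (E - {e}) < card E" and E': "edge_set (E - {e})"
      using card_Diff1_less[OF fin e] less.prems(1) by (auto simp: edge_set_def)
    let ?S = "\<lambda>E R. {T. T \<subseteq> E \<and> minimal_cover h V R T}"
    \<comment> \<open>Sort the covers by whether they contain \<open>e\<close>; those that do arise
      by adding \<open>e\<close> to a minimal cover for the larger root set.\<close>
    have "?S E R \<subseteq> ?S (E - {e}) R \<union> insert e ` ?S (E - {e}) (insert u R)"
    proof
      fix T assume T: "T \<in> ?S E R"
      show "T \<in> ?S (E - {e}) R \<union> insert e ` ?S (E - {e}) (insert u R)"
      proof (cases "e \<in> T")
        case False
        then show ?thesis using T by auto
      next
        case True
        then have "T - {e} \<in> ?S (E - {e}) (insert u R)"
          using T minimal_cover_contract[of h V R T e r u] True he(1) r by auto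
        moreover have "T = insert e (T - {e})"
          using True by auto
        ultimately show ?thesis by blast
      qed
    qed
    then have "card (?S E R) \<le> card (?S (E - {e}) R \<union> insert e ` ?S (E - {e}) (insert u R))"
      using fin by (intro card_mono) auto
    also have "\<dots> \<le> card (?S (E - {e}) R) + card (insert e ` ?S (E - {e}) (insert u R))"
      by (rule card_Un_le)
    also have "card (insert e ` ?S (E - {e}) (insert u R)) \<le> card (?S (E - {e}) (insert u R))"
      using fin by (intro card_image_le) auto
    finally have "real (card (?S E R)) \<le> real (card (?S (E - {e}) R)) + real (card (?S (E - {e}) (insert u R)))"
      by linarith
    also have "\<dots> \<le> fdet n (grounded_laplacian h f R (E - {e})) +
        fdet n (grounded_laplacian h f (insert u R) (E - {e}))"
      using less.prems(2) he(2) by (intro add_mono less.hyps[OF smaller E']) auto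
    also have "\<dots> = fdet n (grounded_laplacian h f R E)"
      by (rule fdet_grounded_laplacian_contract[symmetric, OF fin e he(1) r he(2) u])
    finally show ?thesis .
  next
    case no_edge: False
    show ?thesis
    proof (cases "V \<subseteq> R")
      case True
      then have "covers h V R T" for T
        by (auto simp: covers_def)
      then have "{T. T \<subseteq> E \<and> minimal_cover h V R T} \<subseteq> {{}}"
        by (auto simp: minimal_cover_def)
      then have "card {T. T \<subseteq> E \<and> minimal_cover h V R T} \<le> card {{} :: 'e set}"
        by (intro card_mono) simp_all
      moreover have "f i \<in> R" if "i < n" for i
        using True enum that by (auto simp: bij_betw_def)
      then have "fdet n (grounded_laplacian h f R E) = 1"
        by (subst fdet_upper_triangular) (auto simp: grounded_laplacian_def)
      ultimately show ?thesis by simp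
    next
      case False
      then obtain v where v: "v \<in> V" "v \<notin> R" by blast
      \<comment> \<open>A path that starts in \<open>R\<close> never leaves \<open>R\<close>, so it
        misses \<open>v\<close>.\<close>
      have "\<not> covers h V R T" if T: "T \<subseteq> E" for T
      proof
        assume "covers h V R T"
        then obtain r where r: "r \<in> R" "(r, v) \<in> (joined h T)\<^sup>*"
          using v(1) by (auto simp: covers_def)
        from r(2) have "v \<in> R"
        proof (induction rule: rtrancl_induct)
          case (step y z)
          then show ?case
            using no_edge T by (auto simp: joined_def)
        qed (rule r(1))
        then show False using v(2) by simp
      qed
      then have "{T. T \<subseteq> E \<and> minimal_cover h V R T} = {}"
        by (auto simp: minimal_cover_def)
      moreover have "fdet n (grounded_laplacian h f R E) = 0"
        by (rule fdet_grounded_laplacian_singular[OF less.prems(1) v]) (use no_edge in blast)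
      ultimately show ?thesis by (simp only: card.empty of_nat_0 order_refl)
    qed
  qed
qed

end

section \<open>The bound on the number of spanning trees\<close>

lemma num_spanning_trees_le:
  fixes t :: real
  assumes G: "finite_loopless_multigraph G" and V: "vertices G \<noteq> {}" and t: "t > 0"
  shows "t * real (card (vertices G)) ^ 2 * real (num_spanning_trees G) \<le>
    (\<Prod>v\<in>vertices G. t + real (vertex_degree G v))"
proof -
  have fin: "finite (vertices G)" "finite (edges G)"
    using G by (auto simp: finite_loopless_multigraph_def)
  obtain m where m: "card (vertices G) = Suc m"
    using fin(1) V by (metis card_eq_0_iff not0_implies_Suc)
  obtain f where f: "bij_betw f {..<Suc m} (vertices G)"
    using ex_bij_betw_nat_finite[OF fin(1)] m by (auto simp: atLeast0LessThan)
  interpret enumerated_multigraph "ends G" "vertices G" "Suc m" f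
    by unfold_locales (rule f)
  have E: "edge_set (edges G)"
    using G by (auto simp: edge_set_def finite_loopless_multigraph_def)
  let ?L = "laplacian (ends G) f (edges G)"
  have r: "f 0 \<in> vertices G"
    using f by (auto simp: bij_betw_def)
  have "num_spanning_trees G \<le> card {T. T \<subseteq> edges G \<and> minimal_cover (ends G) (vertices G) {f 0} T}"
    unfolding num_spanning_trees_def
    using fin(2) minimal_cover_spanning_tree[OF G _ r] by (intro card_mono) (auto simp: spanning_trees_def)
  also have "real \<dots> \<le> fdet (Suc m) (grounded_laplacian (ends G) f {f 0} (edges G))"
    using E r by (intro card_minimal_covers_le_fdet) auto
  \<comment> \<open>The root has index 0, so row and column 0 are those of the identity, and
    dropping them leaves the reduced Laplacian.\<close>
  also have "\<dots> = fdet m (\<lambda>i j. grounded_laplacian (ends G) f {f 0} (edges G) (Suc i) (Suc j))"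
    by (subst fdet_column_0) (auto simp: grounded_laplacian_def)
  also have "\<dots> = fdet m (\<lambda>i j. ?L (Suc i) (Suc j))"
    by (rule fdet_cong) (auto simp: grounded_laplacian_def enum_eq_iff)
  finally have "t * real (Suc m) ^ 2 * real (num_spanning_trees G) \<le>
      t * real (Suc m) ^ 2 * fdet m (\<lambda>i j. ?L (Suc i) (Suc j))"
    using t by (intro mult_left_mono) auto
  also have "\<dots> = fdet (Suc m) (\<lambda>i j. ?L i j + t)"
  proof (rule fdet_add_constant[symmetric])
    show "(\<Sum>j<Suc m. ?L i j) = 0" if "i < Suc m" for i
      using laplacian_row_sum[OF E that] .
    then show "(\<Sum>i<Suc m. ?L i j) = 0" if "j < Suc m" for j
      using that by (subst laplacian_sym)
  qed (use t in simp)
  also have "\<dots> \<le> (\<Prod>i<Suc m. ?L i i + t)"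
    using t by (intro Hadamard_psd psd_laplacian_add_constant[OF E]) simp
  also have "\<dots> = (\<Prod>i<Suc m. t + real (vertex_degree G (f i)))"
  proof (rule prod.cong)
    fix i
    \<comment> \<open>Each edge at \<open>f i\<close> contributes 1 to the diagonal entry.\<close>
    have "?L i i = real (vertex_degree G (f i))"
      using fin(2) by (simp add: laplacian_def vertex_degree_def sum.If_cases Int_def)
    then show "?L i i + t = t + real (vertex_degree G (f i))"
      by simp
  qed simp
  also have "\<dots> = (\<Prod>v\<in>vertices G. t + real (vertex_degree G v))"
    by (rule prod.reindex_bij_betw[OF f])
  finally show ?thesis
    unfolding m .
qed

text \<open>A product ignores order, so the sorted list may be replaced by its multiset.\<close>

lemma prod_degree_sequence:
  fixes g :: "nat \<Rightarrow> real"
  assumes "finite (vertices G)"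
  shows "(\<Prod>i<card (vertices G). g (degree_sequence G ! i)) = (\<Prod>v\<in>vertices G. g (vertex_degree G v))"
proof -
  let ?d = "degree_sequence G"
  have mset: "mset ?d = image_mset (vertex_degree G) (mset_set (vertices G))"
    by (simp add: degree_sequence_def)
  then have "length ?d = card (vertices G)"
    by (metis size_image_mset size_mset size_mset_set)
  then have "(\<Prod>i<card (vertices G). g (?d ! i)) = prod_list (map g ?d)"
    by (simp add: prod.list_conv_set_nth atLeast0LessThan)
  also have "\<dots> = prod_mset (image_mset g (mset ?d))"
    by (metis mset_map prod_mset_prod_list)
  also have "\<dots> = (\<Prod>v\<in>vertices G. g (vertex_degree G v))"
    by (simp add: mset prod_unfold_prod_mset image_mset.compositionality comp_def)
  finally show ?thesis .
qed

theorem theorem4p2: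
  fixes G :: "('v, 'e) multigraph" and n \<Delta> :: nat and d :: "nat list"
  assumes "finite_loopless_multigraph G"
    and "n = card (vertices G)"
    and "\<Delta> = max_edge_multiplicity G"
    and "\<Delta> \<ge> 1"
    and "d = degree_sequence G"
  shows "real (num_spanning_trees G)
           \<le> (\<Prod>i<n. real \<Delta> + real (d ! i)) / (real \<Delta> * real n ^ 2)"
proof -
  have fin: "finite (vertices G)"
    using assms(1) by (simp add: finite_loopless_multigraph_def)
  \<comment> \<open>Without vertices the maximum would be the inserted 0, against the assumption
    that it is at least 1.\<close>
  have V: "vertices G \<noteq> {}"
    using assms(3,4) by (auto simp: max_edge_multiplicity_def)
  then have "n > 0"
    using assms(2) fin by (simp add: card_gt_0_iff)
  have "real \<Delta> * real n ^ 2 * real (num_spanning_trees G) \<le> (\<Prod>i<n. real \<Delta> + real (d ! i))"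
    using num_spanning_trees_le[OF assms(1) V, of "real \<Delta>"] assms(4)
    prod_degree_sequence[OF fin, of "\<lambda>k. real \<Delta> + real k"]
    unfolding assms(2,5) by simp
  then show ?thesis
    using \<open>n > 0\<close> assms(4) by (simp add: field_simps)
qed

end
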